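(* Let $k$ be an algebraically closed field of characteristic zero, let $n\ge 1$, and let $G$ be a finite subgroup of $\mathrm{GL}_n(k)$, acting linearly on $\mathbf A^n$. For an integer $d\ge 0$ let $k[x_1,\ldots,x_n]_d^G$ be the space of $G$-invariant forms of degree $d$. (a) If $k[x_1,\ldots,x_n]_d^G\ne 0$, then $G$ admits a polynomial homogeneous self-compression $\mathbf A^n\to\mathbf A^n$ of degree $d+1$, which for $d\ne 0$ is nontrivial. (b) If $|G|$ divides $d$, then $k[x_1,\ldots,x_n]_d^G\ne 0$.
   Context: A self-compression of $G$ is a dominant rational map $\varphi\colon\mathbf A^n\dashrightarrow\mathbf A^n$ with $\varphi\circ g=g\circ\varphi$ for all $g\in G$; it is nontrivial if it is not a birational isomorphism. It is polynomial homogeneous of degree $e$ if $\varphi=(\varphi_1,\ldots,\varphi_n)$ with all $\varphi_i\in k[x_1,\ldots,x_n]$ forms of degree $e$. *)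

theory Defs
  imports
    "HOL-Analysis.Analysis"
    "HOL-Algebra.Group"
    "HOL-Library.Poly_Mapping"
    "HOL-Computational_Algebra.Polynomial_Factorial"
begin

text \<open>
  The affine space $\mathbf{A}^n$ over a field $k$ is the type \<open>'k ^ 'n\<close>, whose coordinates are
  indexed by a nonempty finite type \<open>'n\<close>; thus $n \ge 1$ is arbitrary.  The linear order on \<open>'n\<close>
  is the order of the variables; the library uses it for the instance that makes the polynomial
  ring an integral domain, so that its fraction field is available as the type \<open>_ fract\<close>.
\<close>

type_synonym ('n, 'k) mpoly = "('n \<Rightarrow>\<^sub>0 nat) \<Rightarrow>\<^sub>0 'k"

type_synonym ('n, 'k) ratfun = "('n, 'k) mpoly fract"

definition mconst :: "'k::field \<Rightarrow> ('n, 'k) mpoly" where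
  "mconst c = Poly_Mapping.single 0 c"

definition mvar :: "'n \<Rightarrow> ('n, 'k::field) mpoly" where
  "mvar i = Poly_Mapping.single (Poly_Mapping.single i 1) 1"

text \<open>
  The value of a polynomial at a point with coordinates in a commutative ring \<open>'r\<close>, where the
  coefficients are mapped to \<open>'r\<close> by a ring homomorphism \<open>h\<close>.  With \<open>h = id\<close> this is the value at
  a point of affine space; with \<open>h = mconst\<close> it is substitution of polynomials.
\<close>

definition meval :: "('k::field \<Rightarrow> 'r::comm_ring_1) \<Rightarrow> 'r ^ 'n \<Rightarrow> ('n::finite, 'k) mpoly \<Rightarrow> 'r" where
  "meval h x p = (\<Sum>m\<in>Poly_Mapping.keys p.
     h (Poly_Mapping.lookup p m) * (\<Prod>i\<in>UNIV. (x $ i) ^ Poly_Mapping.lookup m i))"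

text \<open>The zero polynomial counts as a form of every degree.\<close>

definition is_form :: "nat \<Rightarrow> ('n::finite, 'k::field) mpoly \<Rightarrow> bool" where
  "is_form d p \<longleftrightarrow>
     (\<forall>m\<in>Poly_Mapping.keys p. (\<Sum>i\<in>UNIV. Poly_Mapping.lookup m i) = d)"

definition GL :: "('k::field ^ 'n ^ 'n) monoid" where
  "GL = \<lparr>carrier = {A. invertible A}, mult = (**), one = mat 1\<rparr>"

text \<open>The coordinates of the linear map \<open>v \<mapsto> g *v v\<close>, as linear forms.\<close>

definition lin_forms :: "'k::field ^ 'n ^ 'n \<Rightarrow> ('n::finite, 'k) mpoly ^ 'n" where
  "lin_forms g = (\<chi> i. \<Sum>j\<in>UNIV. mconst (g $ i $ j) * mvar j)"

text \<open>
  Invariance of \<open>p\<close> means \<open>p \<circ> g = p\<close> for all \<open>g \<in> G\<close>; as \<open>G\<close> is a group, it makes no difference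
  whether \<open>g\<close> acts on polynomials by composition with \<open>g\<close> or with its inverse.
\<close>

definition invariant_forms ::
    "('k::field ^ 'n ^ 'n) set \<Rightarrow> nat \<Rightarrow> ('n::finite, 'k) mpoly set" where
  "invariant_forms G d =
     {p. is_form d p \<and> (\<forall>g\<in>G. meval mconst (lin_forms g) p = p)}"

text \<open>
  The rational function \<open>f\<close> is defined at the point \<open>x\<close> and has the value \<open>y\<close> there: in some
  representation of \<open>f\<close> as a fraction the denominator does not vanish at \<open>x\<close>.  The point may have
  coordinates in an extension field of the coefficient field, with embedding \<open>h\<close>.
\<close>

definition has_value ::
    "('k::field \<Rightarrow> 'r::field) \<Rightarrow> ('n::{finite,linorder}, 'k) ratfun \<Rightarrow> 'r ^ 'n::{finite,linorder} \<Rightarrow> 'r \<Rightarrow> bool" where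
  "has_value h f x y \<longleftrightarrow>
     (\<exists>p q. meval h x q \<noteq> 0 \<and> f = Fract p q \<and> y = meval h x p / meval h x q)"

text \<open>
  A rational map from $\mathbf{A}^n$ to itself is the tuple of its coordinate functions in
  $k(x_1,\ldots,x_n)$.  Over an infinite field, two rational maps coincide on a nonempty open set
  iff these tuples are equal.
\<close>

type_synonym ('n, 'k) ratmap = "('n, 'k) ratfun ^ 'n"

definition ratmap_of :: "('n::{finite,linorder}, 'k::field) mpoly ^ 'n::{finite,linorder} \<Rightarrow> ('n, 'k) ratmap" where
  "ratmap_of P = (\<chi> i. to_fract (P $ i))"

definition ratmap_id :: "('n::{finite,linorder}, 'k::field) ratmap" where
  "ratmap_id = ratmap_of (\<chi> i. mvar i)"

text \<open>
  The coordinates of \<open>\<psi> \<circ> \<phi>\<close> are the values of those of \<open>\<psi>\<close> at the point \<open>\<phi>\<close> with coordinates in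
  $k(x_1,\ldots,x_n)$.  These values exist whenever \<open>\<phi>\<close> is dominant.
\<close>

definition ratmap_comp ::
    "('n::{finite,linorder}, 'k::field) ratmap \<Rightarrow> ('n, 'k) ratmap \<Rightarrow> ('n, 'k) ratmap" where
  "ratmap_comp \<psi> \<phi> = (\<chi> i. THE y. has_value (\<lambda>c. to_fract (mconst c)) (\<psi> $ i) \<phi> y)"

definition ratmap_image :: "('n::{finite,linorder}, 'k::field) ratmap \<Rightarrow> ('k ^ 'n::{finite,linorder}) set" where
  "ratmap_image \<phi> = {b. \<exists>a. \<forall>i. has_value id (\<phi> $ i) a (b $ i)}"

definition zariski_closure :: "('k::field ^ 'n::finite) set \<Rightarrow> ('k ^ 'n) set" where
  "zariski_closure S =
     {b. \<forall>p. (\<forall>a\<in>S. meval id a p = 0) \<longrightarrow> meval id b p = 0}"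

definition dominant :: "('n::{finite,linorder}, 'k::field) ratmap \<Rightarrow> bool" where
  "dominant \<phi> \<longleftrightarrow> zariski_closure (ratmap_image \<phi>) = UNIV"

definition birational :: "('n::{finite,linorder}, 'k::field) ratmap \<Rightarrow> bool" where
  "birational \<phi> \<longleftrightarrow> dominant \<phi> \<and>
     (\<exists>\<psi>. dominant \<psi> \<and> ratmap_comp \<psi> \<phi> = ratmap_id \<and> ratmap_comp \<phi> \<psi> = ratmap_id)"

definition self_compression ::
    "('k::field ^ 'n::{finite,linorder} ^ 'n::{finite,linorder}) set \<Rightarrow> ('n, 'k) ratmap \<Rightarrow> bool" where
  "self_compression G \<phi> \<longleftrightarrow> dominant \<phi> \<and>
     (\<forall>g\<in>G. ratmap_comp \<phi> (ratmap_of (lin_forms g)) = ratmap_comp (ratmap_of (lin_forms g)) \<phi>)"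

definition nontrivial :: "('n::{finite,linorder}, 'k::field) ratmap \<Rightarrow> bool" where
  "nontrivial \<phi> \<longleftrightarrow> \<not> birational \<phi>"

definition polynomial_homogeneous ::
    "nat \<Rightarrow> ('n::{finite,linorder}, 'k::field) ratmap \<Rightarrow> bool" where
  "polynomial_homogeneous e \<phi> \<longleftrightarrow> (\<exists>P. (\<forall>i. is_form e (P $ i)) \<and> \<phi> = ratmap_of P)"

end

theory Submission
  imports Defs
begin

text \<open>
  For an invariant form \<open>f \<noteq> 0\<close> of degree \<open>d\<close> take \<open>\<phi>(x) = f(x) x\<close>.  It is equivariant, and it
  maps the line through \<open>b\<close> to itself by \<open>t b \<mapsto> t\<^bsup>d+1\<^esup> f(b) b\<close>; hence \<open>b\<close> is in the image as soon as
  \<open>f(b) \<noteq> 0\<close>, so \<open>\<phi>\<close> is dominant.  If \<open>d > 0\<close>, there is \<open>\<zeta> \<noteq> 1\<close> with \<open>\<zeta>\<^bsup>d+1\<^esup> = 1\<close>, and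
  \<open>\<phi>(\<zeta> x) = \<phi>(x)\<close> rules out a rational left inverse.  For (b), the product of the \<open>G\<close>-translates
  of a coordinate function is an invariant form of degree \<open>|G|\<close>, and its powers are as required.
\<close>

section \<open>Evaluation of polynomials\<close>

text \<open>One notion covers all maps in play: the coefficient embeddings \<open>id\<close>,
  \<open>mconst\<close> and \<open>to_fract\<close>, and the evaluations and substitutions
  \<open>meval h x\<close> that they induce.\<close>

locale unital_ring_hom =
  fixes h :: "'a::comm_ring_1 \<Rightarrow> 'b::comm_ring_1"
  assumes hom_zero: "h 0 = 0" and hom_one: "h 1 = 1"
    and hom_add: "h (a + b) = h a + h b" and hom_mult: "h (a * b) = h a * h b"
begin

lemma hom_sum: "h (sum f A) = (\<Sum>x\<in>A. h (f x))"
  by (induction A rule: infinite_finite_induct) (auto simp: hom_zero hom_add)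

lemma hom_prod: "h (prod f A) = (\<Prod>x\<in>A. h (f x))"
  by (induction A rule: infinite_finite_induct) (auto simp: hom_one hom_mult)

lemma hom_power: "h (a ^ n) = h a ^ n"
  by (induction n) (auto simp: hom_one hom_mult)

end

lemma poly_mapping_eq_sum_single:
  "p = (\<Sum>m\<in>Poly_Mapping.keys p. Poly_Mapping.single m (Poly_Mapping.lookup p m))"
  by (rule poly_mapping_eqI)
     (auto simp: lookup_sum lookup_single when_def in_keys_iff if_distrib cong: if_cong)

lemma unital_ring_hom_id: "unital_ring_hom id"
  by unfold_locales auto

lemma unital_ring_hom_to_fract: "unital_ring_hom to_fract"
  by unfold_locales auto

lemma unital_ring_hom_mconst: "unital_ring_hom mconst"
  by unfold_locales (auto simp: mconst_def single_add mult_single)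

lemma unital_ring_hom_comp:
  "unital_ring_hom g \<Longrightarrow> unital_ring_hom h \<Longrightarrow> unital_ring_hom (\<lambda>x. g (h x))"
  unfolding unital_ring_hom_def by simp

text \<open>Absent exponents have coefficient 0, so two polynomials can be evaluated over one common
  index set.\<close>

lemma meval_superset:
  assumes "unital_ring_hom h" "finite A" "Poly_Mapping.keys p \<subseteq> A"
  shows "meval h x p =
    (\<Sum>m\<in>A. h (Poly_Mapping.lookup p m) * (\<Prod>i\<in>UNIV. (x $ i) ^ Poly_Mapping.lookup m i))"
  unfolding meval_def using assms
  by (intro sum.mono_neutral_left) (auto simp: in_keys_iff unital_ring_hom.hom_zero)

lemma meval_zero [simp]: "meval h x 0 = 0"
  by (simp add: meval_def)

lemma meval_add:
  assumes "unital_ring_hom h"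
  shows "meval h x (p + q) = meval h x p + meval h x q"
proof -
  interpret unital_ring_hom h by fact
  let ?A = "Poly_Mapping.keys p \<union> Poly_Mapping.keys q"
  have "Poly_Mapping.keys (p + q) \<subseteq> ?A" by (rule keys_add)
  then show ?thesis
    by (simp add: meval_superset[OF assms, of ?A] lookup_add hom_add distrib_right sum.distrib)
qed

lemma meval_sum:
  assumes "unital_ring_hom h"
  shows "meval h x (sum f A) = (\<Sum>a\<in>A. meval h x (f a))"
  by (induction A rule: infinite_finite_induct) (auto simp: meval_add assms)

lemma meval_single:
  assumes "unital_ring_hom h"
  shows "meval h x (Poly_Mapping.single m c) =
    h c * (\<Prod>i\<in>UNIV. (x $ i) ^ Poly_Mapping.lookup m i)"
proof -
  interpret unital_ring_hom h by fact
  show ?thesis by (subst meval_superset[OF assms, of "{m}"]) auto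
qed

text \<open>On monomials exponents add; bilinearity does the rest.\<close>

lemma meval_mult:
  fixes p q :: "('n::finite, 'k::field) mpoly"
  assumes "unital_ring_hom h"
  shows "meval h x (p * q) = meval h x p * meval h x q"
proof -
  interpret unital_ring_hom h by fact
  have *: "meval h x (Poly_Mapping.single m c * Poly_Mapping.single n e) =
      meval h x (Poly_Mapping.single m c) * meval h x (Poly_Mapping.single n e)" for m n c e
    by (simp add: mult_single meval_single[OF assms] lookup_add hom_mult power_add
        prod.distrib algebra_simps)
  let ?s = "\<lambda>p m. Poly_Mapping.single m (Poly_Mapping.lookup p m)"
  have expand: "(\<Sum>m\<in>Poly_Mapping.keys r. ?s r m) = r" for r :: "('n, 'k) mpoly"
    by (rule poly_mapping_eq_sum_single[symmetric])
  have "meval h x ((\<Sum>m\<in>Poly_Mapping.keys p. ?s p m) * (\<Sum>n\<in>Poly_Mapping.keys q. ?s q n)) =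
      meval h x (\<Sum>m\<in>Poly_Mapping.keys p. ?s p m) * meval h x (\<Sum>n\<in>Poly_Mapping.keys q. ?s q n)"
    by (simp only: sum_product meval_sum[OF assms] *)
  then show ?thesis by (simp only: expand)
qed

lemma unital_ring_hom_meval:
  assumes "unital_ring_hom h"
  shows "unital_ring_hom (meval h x)"
proof -
  have "meval h x 1 = 1"
    using meval_single[OF assms, of x 0 1] unital_ring_hom.hom_one[OF assms] by simp
  with assms show ?thesis by unfold_locales (auto simp: meval_add meval_mult)
qed

lemma meval_mconst:
  assumes "unital_ring_hom h"
  shows "meval h x (mconst c) = h c"
  by (simp add: mconst_def meval_single assms)

lemma meval_mvar:
  assumes "unital_ring_hom h"
  shows "meval h x (mvar i) = x $ i"
proof -
  have "(\<Prod>j\<in>UNIV. (x $ j) ^ Poly_Mapping.lookup (Poly_Mapping.single i 1) j) =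
      (\<Prod>j\<in>UNIV. if j = i then x $ j else 1)"
    by (rule prod.cong) (auto simp: lookup_single when_def)
  then show ?thesis
    by (simp add: mvar_def meval_single assms unital_ring_hom.hom_one)
qed

text \<open>Taking an evaluation for \<open>e\<close> yields the composition law for substitutions;
  taking \<open>to_fract\<close> yields the passage to the function field.\<close>

lemma hom_meval:
  assumes "unital_ring_hom e"
  shows "e (meval h x p) = meval (\<lambda>c. e (h c)) (\<chi> i. e (x $ i)) p"
proof -
  interpret unital_ring_hom e by fact
  show ?thesis by (simp add: meval_def hom_sum hom_mult hom_prod hom_power)
qed

lemma meval_meval:
  assumes "unital_ring_hom h"
  shows "meval h x (meval mconst P q) = meval h (\<chi> i. meval h x (P $ i)) q"
  by (subst hom_meval[OF unital_ring_hom_meval[OF assms]]) (simp add: meval_mconst assms)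

lemmas meval_id_simps = meval_add[OF unital_ring_hom_id] meval_mult[OF unital_ring_hom_id]
  meval_sum[OF unital_ring_hom_id] meval_mconst[OF unital_ring_hom_id]
  meval_mvar[OF unital_ring_hom_id] meval_meval[OF unital_ring_hom_id]

lemmas meval_mconst_simps = meval_add[OF unital_ring_hom_mconst]
  meval_mult[OF unital_ring_hom_mconst] meval_sum[OF unital_ring_hom_mconst]
  meval_mconst[OF unital_ring_hom_mconst] meval_mvar[OF unital_ring_hom_mconst]
  meval_meval[OF unital_ring_hom_mconst]

text \<open>Monomials are pairwise distinct characters; this is Dedekind's independence argument.\<close>

lemma monomial_functions_independent:
  fixes c :: "('n::finite \<Rightarrow>\<^sub>0 nat) \<Rightarrow> 'k::field_char_0"
  assumes "finite M"
    and "\<And>x::'k ^ 'n. (\<Sum>m\<in>M. c m * (\<Prod>i\<in>UNIV. (x $ i) ^ Poly_Mapping.lookup m i)) = 0"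
    and "m \<in> M"
  shows "c m = 0"
  using assms
proof (induction M arbitrary: c m rule: finite_induct)
  case empty
  then show ?case by simp
next
  case (insert m0 M)
  define X :: "('n \<Rightarrow>\<^sub>0 nat) \<Rightarrow> 'k ^ 'n \<Rightarrow> 'k"
    where "X m x = (\<Prod>i\<in>UNIV. (x $ i) ^ Poly_Mapping.lookup m i)" for m x
  have mult: "X m (\<chi> i. a $ i * x $ i) = X m a * X m x" for m a x
    by (simp add: X_def power_mult_distrib prod.distrib)
  have rel: "c m0 * X m0 x + (\<Sum>m\<in>M. c m * X m x) = 0" for x
    using insert.prems(1)[of x] insert.hyps by (simp add: X_def)
  have zero: "c m = 0" if "m \<in> M" for m
  proof -
    from that insert.hyps have "m \<noteq> m0" by auto
    then obtain j where j: "Poly_Mapping.lookup m j \<noteq> Poly_Mapping.lookup m0 j"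
      by (meson poly_mapping_eqI)
    \<comment> \<open>At this point each monomial becomes a power of 2 recording its
      \<open>j\<close>-th exponent, and in characteristic zero distinct powers of 2 differ.\<close>
    define a :: "'k ^ 'n" where "a = (\<chi> i. if i = j then 2 else 1)"
    have a: "X m' a = 2 ^ Poly_Mapping.lookup m' j" for m'
    proof -
      have "X m' a = (\<Prod>i\<in>UNIV. if i = j then 2 ^ Poly_Mapping.lookup m' j else 1)"
        unfolding X_def a_def by (rule prod.cong) auto
      then show ?thesis by simp
    qed
    have "X m a \<noteq> X m0 a"
    proof
      assume "X m a = X m0 a"
      then have "of_nat (2 ^ Poly_Mapping.lookup m j) = (of_nat (2 ^ Poly_Mapping.lookup m0 j) :: 'k)"
        by (simp add: a)
      with j show False unfolding of_nat_eq_iff by simp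
    qed
    \<comment> \<open>Take the relation at the point \<open>x\<close> scaled coordinatewise by
      \<open>a\<close> and subtract \<open>X m0 a\<close> times the relation at \<open>x\<close>:
      the \<open>m0\<close> term cancels, leaving a relation supported on \<open>M\<close>.\<close>
    moreover have "c m * (X m a - X m0 a) = 0"
    proof (rule insert.IH[OF _ that])
      fix x
      have "(\<Sum>m\<in>M. c m * (X m a - X m0 a) * X m x) =
          (\<Sum>m\<in>M. c m * X m (\<chi> i. a $ i * x $ i)) - X m0 a * (\<Sum>m\<in>M. c m * X m x)"
        by (simp add: mult algebra_simps sum_subtractf sum_distrib_left)
      also have "\<dots> = - c m0 * X m0 (\<chi> i. a $ i * x $ i) + X m0 a * (c m0 * X m0 x)"
        using rel[of "\<chi> i. a $ i * x $ i"] rel[of x]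
        by (simp add: eq_neg_iff_add_eq_0[symmetric] add_eq_0_iff)
      also have "\<dots> = 0" by (simp add: mult)
      finally show "(\<Sum>m\<in>M. c m * (X m a - X m0 a) *
          (\<Prod>i\<in>UNIV. (x $ i) ^ Poly_Mapping.lookup m i)) = 0"
        by (simp add: X_def)
    qed
    ultimately show ?thesis by simp
  qed
  \<comment> \<open>At the all-ones point \<open>X m0\<close> is 1, and the other coefficients are
    already zero.\<close>
  moreover have "c m0 = 0"
    using rel[of "\<chi> i. 1"] zero by (simp add: X_def)
  ultimately show ?case using insert.prems(2) by blast
qed

text \<open>The passage from pointwise identities to polynomial ones; characteristic zero supplies
  enough points.\<close>

lemma mpoly_eq_0_if_meval_eq_0:
  fixes p :: "('n::finite, 'k::field_char_0) mpoly"
  assumes "\<And>x. meval id x p = 0"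
  shows "p = 0"
proof (rule ccontr)
  assume "p \<noteq> 0"
  then obtain m where "m \<in> Poly_Mapping.keys p"
    by (metis poly_mapping_eq_sum_single all_not_in_conv sum.empty)
  moreover have "Poly_Mapping.lookup p m = 0"
    using assms calculation
    by (intro monomial_functions_independent[of "Poly_Mapping.keys p" "Poly_Mapping.lookup p"])
       (auto simp: meval_def)
  ultimately show False by (simp add: in_keys_iff)
qed

section \<open>Forms\<close>

lemma is_form_mult:
  assumes "is_form d p" "is_form e q"
  shows "is_form (d + e) (p * q)"
proof -
  have "(\<Sum>i\<in>UNIV. Poly_Mapping.lookup m i) = d + e" if "m \<in> Poly_Mapping.keys (p * q)" for m
  proof -
    from that keys_mult[of p q] obtain a b
      where "m = a + b" "a \<in> Poly_Mapping.keys p" "b \<in> Poly_Mapping.keys q" by blast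
    with assms show ?thesis by (simp add: is_form_def lookup_add sum.distrib)
  qed
  then show ?thesis by (simp add: is_form_def)
qed

lemma is_form_1: "is_form 0 1"
  by (simp add: is_form_def)

lemma is_form_prod:
  assumes "\<And>a. a \<in> A \<Longrightarrow> is_form d (f a)"
  shows "is_form (card A * d) (prod f A)"
  using assms
  by (induction A rule: infinite_finite_induct) (auto simp: is_form_1 intro: is_form_mult)

lemma is_form_power: "is_form d p \<Longrightarrow> is_form (n * d) (p ^ n)"
  by (induction n) (auto simp: is_form_1 intro: is_form_mult)

lemma is_form_sum:
  assumes "\<And>a. a \<in> A \<Longrightarrow> is_form d (f a)"
  shows "is_form d (sum f A)"
  using assms keys_sum[of f A] unfolding is_form_def by blast

lemma is_form_mconst: "is_form 0 (mconst c)"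
  by (simp add: is_form_def mconst_def)

lemma is_form_mvar: "is_form 1 (mvar i)"
  by (simp add: is_form_def mvar_def lookup_single when_def)

lemma is_form_lin_forms: "is_form 1 (lin_forms g $ i)"
  using is_form_mult[OF is_form_mconst is_form_mvar]
  by (auto simp: lin_forms_def intro!: is_form_sum)

lemma meval_scale_form:
  assumes "is_form d p"
  shows "meval id (t *s a) p = t ^ d * meval id a p"
  using assms unfolding meval_def sum_distrib_left
  by (intro sum.cong)
     (auto simp: is_form_def power_mult_distrib prod.distrib power_sum[symmetric] algebra_simps)

section \<open>Linear forms\<close>

lemma meval_lin_forms: "meval id x (lin_forms g $ i) = (g *v x) $ i"
  by (simp add: lin_forms_def meval_id_simps matrix_vector_mult_def)

text \<open>The substituted matrix acts first, hence stands on the right. On a product over a group,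
  substitution therefore acts by right translation of the index.\<close>

lemma meval_lin_forms_lin_forms:
  fixes g h :: "'k::field ^ 'n::finite ^ 'n"
  shows "meval mconst (lin_forms h) (lin_forms g $ i) = lin_forms (g ** h) $ i"
proof -
  interpret unital_ring_hom "mconst :: 'k \<Rightarrow> ('n, 'k) mpoly" by (rule unital_ring_hom_mconst)
  have "meval mconst (lin_forms h) (lin_forms g $ i) =
      (\<Sum>j\<in>UNIV. \<Sum>k\<in>UNIV. mconst (g $ i $ j) * (mconst (h $ j $ k) * mvar k))"
    by (simp add: lin_forms_def meval_mconst_simps sum_distrib_left)
  also have "\<dots> = (\<Sum>k\<in>UNIV. \<Sum>j\<in>UNIV. mconst (g $ i $ j) * (mconst (h $ j $ k) * mvar k))"
    by (rule sum.swap)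
  also have "\<dots> = lin_forms (g ** h) $ i"
    by (simp add: lin_forms_def matrix_matrix_mult_def hom_sum hom_mult sum_distrib_right
        mult.assoc)
  finally show ?thesis .
qed

text \<open>If \<open>h\<close> is a right inverse of \<open>g\<close>, the form takes the value 1
  at \<open>h *v axis i 1\<close>.\<close>

lemma lin_forms_nonzero:
  assumes "invertible g"
  shows "lin_forms g $ i \<noteq> 0"
proof
  assume 0: "lin_forms g $ i = 0"
  from assms obtain h where "g ** h = mat 1" unfolding invertible_def by blast
  then have "g *v (h *v axis i 1) = axis i 1"
    by (simp add: matrix_vector_mul_assoc)
  then have "meval id (h *v axis i 1) (lin_forms g $ i) = 1"
    by (simp add: meval_lin_forms)
  with 0 show False by simp
qed

section \<open>Polynomial maps as rational maps\<close>

text \<open>Cross-multiply two representations of the fraction. Uniqueness is what gives the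
  \<open>THE\<close> in \<open>ratmap_comp\<close> its meaning.\<close>

lemma has_value_unique:
  assumes "unital_ring_hom h" "has_value h f x y" "has_value h f x z"
  shows "y = z"
proof -
  from assms(2,3) obtain p q p' q' where
    1: "meval h x q \<noteq> 0" "f = Fract p q" "y = meval h x p / meval h x q" and
    2: "meval h x q' \<noteq> 0" "f = Fract p' q'" "z = meval h x p' / meval h x q'"
    unfolding has_value_def by blast
  from 1(1) 2(1) have "q \<noteq> 0" "q' \<noteq> 0" by auto
  with 1(2) 2(2) have "p * q' = p' * q" by (simp add: eq_fract)
  then have "meval h x p * meval h x q' = meval h x p' * meval h x q"
    by (simp flip: meval_mult[OF assms(1)])
  with 1 2 show ?thesis by (simp add: frac_eq_eq)
qed

lemma has_value_Fract_iff:
  assumes "unital_ring_hom h" "meval h x q \<noteq> 0"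
  shows "has_value h (Fract p q) x y \<longleftrightarrow> y = meval h x p / meval h x q"
proof -
  have "has_value h (Fract p q) x (meval h x p / meval h x q)"
    unfolding has_value_def using assms(2) by blast
  with has_value_unique[OF assms(1) this] show ?thesis by blast
qed

lemma has_value_to_fract_iff:
  assumes "unital_ring_hom h"
  shows "has_value h (to_fract p) x y \<longleftrightarrow> y = meval h x p"
proof -
  interpret unital_ring_hom "meval h x" by (rule unital_ring_hom_meval) fact
  show ?thesis
    using has_value_Fract_iff[OF assms, of x 1] by (simp add: to_fract_def hom_one)
qed

lemma unital_ring_hom_to_fract_mconst:
  "unital_ring_hom (\<lambda>c. to_fract (mconst c :: ('n::{finite,linorder}, 'k::field) mpoly))"
  by (rule unital_ring_hom_comp[OF unital_ring_hom_to_fract unital_ring_hom_mconst])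

text \<open>Evaluation at the generic image point in the function field is substitution of
  polynomials, so compositions can be computed in the polynomial ring.\<close>

lemma meval_ratmap_of:
  "meval (\<lambda>c. to_fract (mconst c)) (ratmap_of P) p = to_fract (meval mconst P p)"
  by (simp add: hom_meval[OF unital_ring_hom_to_fract] ratmap_of_def)

lemma ratmap_comp_ratmap_of:
  "ratmap_comp (ratmap_of P) (ratmap_of Q) = ratmap_of (\<chi> i. meval mconst Q (P $ i))"
proof -
  have P: "ratmap_of P $ i = to_fract (P $ i)" for i by (simp add: ratmap_of_def)
  show ?thesis
    unfolding ratmap_comp_def P has_value_to_fract_iff[OF unital_ring_hom_to_fract_mconst]
      meval_ratmap_of the_eq_trivial
    by (simp add: ratmap_of_def)
qed

lemma ratmap_image_ratmap_of:
  "ratmap_image (ratmap_of P) = range (\<lambda>a. \<chi> i. meval id a (P $ i))"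
  by (auto simp: ratmap_image_def ratmap_of_def has_value_to_fract_iff[OF unital_ring_hom_id]
      vec_eq_iff)

text \<open>If the substitution gave 0, \<open>q\<close> would vanish on the image, hence on its
  closure, which is the whole space. Denominators thus survive composition with a dominant
  map.\<close>

lemma dominant_substitution_nonzero:
  fixes P :: "('n::{finite,linorder}, 'k::field_char_0) mpoly ^ 'n::{finite,linorder}"
  assumes "dominant (ratmap_of P)" "q \<noteq> 0"
  shows "meval mconst P q \<noteq> 0"
proof
  assume 0: "meval mconst P q = 0"
  have "meval id b q = 0" if "b \<in> ratmap_image (ratmap_of P)" for b
  proof -
    from that obtain a where "b = (\<chi> i. meval id a (P $ i))" by (auto simp: ratmap_image_ratmap_of)
    then have "meval id b q = meval id a (meval mconst P q)" by (simp add: meval_id_simps)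
    with 0 show ?thesis by simp
  qed
  with assms(1) have "meval id b q = 0" for b
    unfolding dominant_def zariski_closure_def by blast
  with assms(2) show False using mpoly_eq_0_if_meval_eq_0 by blast
qed

text \<open>Write the \<open>i\<close>-th coordinate of \<open>\<psi>\<close> as
  \<open>p / q\<close> and clear denominators: a rational left inverse becomes an identity between
  polynomials.\<close>

lemma ratmap_left_inverseE:
  fixes P :: "('n::{finite,linorder}, 'k::field_char_0) mpoly ^ 'n::{finite,linorder}"
  assumes "dominant (ratmap_of P)" "ratmap_comp \<psi> (ratmap_of P) = ratmap_id"
  obtains p q where "meval mconst P q \<noteq> 0" "meval mconst P p = mvar i * meval mconst P q"
proof -
  let ?h = "\<lambda>c. to_fract (mconst c) :: ('n, 'k) ratfun"
  obtain p q where pq: "\<psi> $ i = Fract p q" "q \<noteq> 0" by (cases "\<psi> $ i") auto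
  then have nz: "meval mconst P q \<noteq> 0" by (intro dominant_substitution_nonzero assms(1))
  have val: "has_value ?h (\<psi> $ i) (ratmap_of P) y \<longleftrightarrow>
      y = to_fract (meval mconst P p) / to_fract (meval mconst P q)" for y
    using has_value_Fract_iff[OF unital_ring_hom_to_fract_mconst, of "ratmap_of P" q p y] nz
    by (simp add: pq(1) meval_ratmap_of)
  have "to_fract (mvar i) = ratmap_comp \<psi> (ratmap_of P) $ i"
    unfolding assms(2) by (simp add: ratmap_id_def ratmap_of_def)
  also have "\<dots> = to_fract (meval mconst P p) / to_fract (meval mconst P q)"
    unfolding ratmap_comp_def vec_lambda_beta val by (rule the_eq_trivial)
  finally have "to_fract (mvar i) * to_fract (meval mconst P q) = to_fract (meval mconst P p)"
    using nz by (simp add: eq_divide_eq)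
  then have "meval mconst P p = mvar i * meval mconst P q"
    unfolding to_fract_mult[symmetric] to_fract_eq_iff by (rule sym)
  with nz show thesis by (rule that)
qed

section \<open>The compression defined by an invariant form\<close>

lemma dominant_radial_map:
  fixes f :: "('n::{finite,linorder}, 'k::{alg_closed_field, field_char_0}) mpoly"
  assumes "is_form d f" "f \<noteq> 0"
  shows "dominant (ratmap_of (\<chi> i. f * mvar i))"
proof -
  have img: "b \<in> ratmap_image (ratmap_of (\<chi> i. f * mvar i))" if "meval id b f \<noteq> 0" for b
  proof -
    \<comment> \<open>The exponent collects \<open>d\<close> from \<open>f\<close> and 1 from the
      coordinate, so \<open>t *s b\<close> is mapped to \<open>b\<close>.\<close>
    obtain t where "t ^ (d + 1) = inverse (meval id b f)"
      using nth_root_exists[of "d + 1"] by auto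
    then have "b = (\<chi> i. meval id (t *s b) (f * mvar i))"
      using that by (simp add: vec_eq_iff meval_id_simps meval_scale_form[OF assms(1)] field_simps)
    then show ?thesis by (auto simp: ratmap_image_ratmap_of)
  qed
  have "meval id b p = 0"
    if p: "\<forall>a\<in>ratmap_image (ratmap_of (\<chi> i. f * mvar i)). meval id a p = 0" for p b
  proof -
    \<comment> \<open>Where \<open>f\<close> vanishes the product is 0; elsewhere the point lies in
      the image, where \<open>p\<close> is 0. Then \<open>f\<close> cancels in the integral
      domain.\<close>
    have "f * p = 0"
      using p img by (intro mpoly_eq_0_if_meval_eq_0) (auto simp: meval_id_simps)
    with assms(2) show ?thesis by simp
  qed
  then show ?thesis by (auto simp: dominant_def zariski_closure_def)
qed

section \<open>Homogeneous maps of degree at least 2 are not birational\<close>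

lemma exists_nontrivial_root_of_unity:
  assumes "d > 0"
  shows "\<exists>z::'k::{alg_closed_field, field_char_0}. z \<noteq> 1 \<and> z ^ (d + 1) = 1"
proof -
  \<comment> \<open>A root of \<open>1 + z + ... + z^d\<close>, the cofactor of \<open>z - 1\<close>
    in \<open>z^(d+1) - 1\<close>. It is not 1, since the sum at 1 is \<open>d + 1\<close>, nonzero
    in characteristic zero.\<close>
  obtain z :: 'k where z: "(\<Sum>k\<le>d. 1 * z ^ k) = 0"
    using alg_closed[of d "\<lambda>_. 1 :: 'k"] assms by auto
  have "z ^ (d + 1) - 1 = (z - 1) * (\<Sum>k\<le>d. z ^ k)"
    using power_diff_1_eq[of z "Suc d"] by (simp add: lessThan_Suc_atMost)
  moreover have "z \<noteq> 1"
  proof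
    assume "z = 1"
    with z have "(of_nat (Suc d) :: 'k) = 0" by simp
    then show False by (simp only: of_nat_eq_0_iff)
  qed
  ultimately show ?thesis using z by auto
qed

lemma nontrivial_polynomial_homogeneous:
  fixes P :: "('n::{finite,linorder}, 'k::{alg_closed_field, field_char_0}) mpoly ^ 'n::{finite,linorder}"
  assumes "\<And>i. is_form (d + 1) (P $ i)" "d > 0"
  shows "nontrivial (ratmap_of P)"
  unfolding nontrivial_def
proof
  assume "birational (ratmap_of P)"
  then obtain \<psi> where dom: "dominant (ratmap_of P)"
    and inv: "ratmap_comp \<psi> (ratmap_of P) = ratmap_id"
    unfolding birational_def by blast
  \<comment> \<open>Any coordinate serves; the index type is nonempty.\<close>
  fix i :: 'n
  obtain p q where q: "meval mconst P q \<noteq> 0"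
    and p: "meval mconst P p = mvar i * meval mconst P q"
    using ratmap_left_inverseE[OF dom inv] .
  obtain z :: 'k where z: "z \<noteq> 1" "z ^ (d + 1) = 1"
    using exists_nontrivial_root_of_unity[OF assms(2)] by blast
  have "meval id a (mvar i * meval mconst P q) = 0" for a
  proof -
    have *: "meval id (z *s a) (P $ j) = meval id a (P $ j)" for j
      using z(2) by (simp only: meval_scale_form[OF assms(1)] mult_1)
    have inv: "meval id (z *s a) (meval mconst P r) = meval id a (meval mconst P r)" for r
      by (simp only: meval_id_simps *)
    \<comment> \<open>Compare the identity \<open>p\<close> at \<open>z *s a\<close> and at
      \<open>a\<close>: everything factoring through \<open>P\<close> is unchanged, while the
      coordinate is multiplied by \<open>z\<close>.\<close>
    have "z * (a $ i * meval id a (meval mconst P q)) = a $ i * meval id a (meval mconst P q)"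
      using inv[of p] inv[of q]
      by (simp add: p meval_mult[OF unital_ring_hom_id] meval_mvar[OF unital_ring_hom_id] mult.assoc)
    with z(1) have "a $ i * meval id a (meval mconst P q) = 0" by simp
    then show ?thesis
      by (simp add: meval_mult[OF unital_ring_hom_id] meval_mvar[OF unital_ring_hom_id])
  qed
  then have "mvar i * meval mconst P q = 0" by (rule mpoly_eq_0_if_meval_eq_0)
  with q have "mvar i = (0 :: ('n, 'k) mpoly)" by simp
  moreover have "meval id (axis i 1) (mvar i) = (1 :: 'k)" by (simp add: meval_id_simps)
  ultimately show False by simp
qed

text \<open>Both composites send \<open>x\<close> to \<open>f(x)\<close> times
  \<open>g *v x\<close>: one by invariance of \<open>f\<close>, the other by linearity of
  \<open>g\<close>.\<close>

lemma self_compression_radial_map: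
  fixes f :: "('n::{finite,linorder}, 'k::{alg_closed_field, field_char_0}) mpoly"
  assumes "f \<in> invariant_forms G d" "f \<noteq> 0"
  shows "self_compression G (ratmap_of (\<chi> i. f * mvar i))"
proof -
  have "meval mconst (lin_forms g) (f * mvar i) =
      meval mconst (\<chi> i. f * mvar i) (lin_forms g $ i)" if "g \<in> G" for g i
  proof -
    have "meval mconst (lin_forms g) f = f" using assms(1) that by (simp add: invariant_forms_def)
    then show ?thesis
      by (simp add: meval_mconst_simps) (simp add: lin_forms_def meval_mconst_simps
          sum_distrib_left algebra_simps)
  qed
  moreover have "dominant (ratmap_of (\<chi> i. f * mvar i))"
    using assms by (intro dominant_radial_map[of d]) (auto simp: invariant_forms_def)
  ultimately show ?thesis by (simp add: self_compression_def ratmap_comp_ratmap_of)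
qed

section \<open>Norms of coordinate functions\<close>

text \<open>Substituting \<open>h\<close> permutes the factors, because right translation by
  \<open>h\<close> is a bijection of \<open>G\<close>.\<close>

lemma prod_lin_forms_invariant:
  fixes G :: "('k::field_char_0 ^ 'n::{finite,linorder} ^ 'n::{finite,linorder}) set"
  assumes "subgroup G GL" "h \<in> G"
  shows "meval mconst (lin_forms h) (\<Prod>g\<in>G. lin_forms g $ i) = (\<Prod>g\<in>G. lin_forms g $ i)"
proof -
  interpret unital_ring_hom "meval mconst (lin_forms h)"
    by (intro unital_ring_hom_meval unital_ring_hom_mconst)
  interpret G: subgroup G GL by fact
  have closed: "a ** b \<in> G" if "a \<in> G" "b \<in> G" for a b
    using G.m_closed[OF that] by (simp add: GL_def)
  from assms(2) have "invertible h" using G.subset by (auto simp: GL_def)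
  then obtain h' where h': "h ** h' = mat 1" "h' ** h = mat 1" unfolding invertible_def by blast
  \<comment> \<open>Identifying the abstract inverse with the matrix inverse lets subgroup closure
    put \<open>h'\<close> into \<open>G\<close>.\<close>
  have "inv\<^bsub>GL\<^esub> h = h'"
    unfolding m_inv_def
  proof (rule the_equality)
    show "h' \<in> carrier GL \<and> h \<otimes>\<^bsub>GL\<^esub> h' = \<one>\<^bsub>GL\<^esub> \<and> h' \<otimes>\<^bsub>GL\<^esub> h = \<one>\<^bsub>GL\<^esub>"
      using h' by (auto simp: GL_def invertible_def)
    show "y = h'" if "y \<in> carrier GL \<and> h \<otimes>\<^bsub>GL\<^esub> y = \<one>\<^bsub>GL\<^esub> \<and> y \<otimes>\<^bsub>GL\<^esub> h = \<one>\<^bsub>GL\<^esub>" for y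
      using that h' by (simp add: GL_def) (metis matrix_mul_assoc matrix_mul_lid matrix_mul_rid)
  qed
  then have "h' \<in> G" using G.m_inv_closed[OF assms(2)] by simp
  then have "bij_betw (\<lambda>g. g ** h) G G"
    using h' assms(2) closed
    by (intro bij_betwI[of _ _ _ "\<lambda>g. g ** h'"]) (auto simp: matrix_mul_assoc[symmetric])
  then have "(\<Prod>g\<in>G. lin_forms (g ** h) $ i) = (\<Prod>g\<in>G. lin_forms g $ i)"
    by (rule prod.reindex_bij_betw)
  then show ?thesis by (simp add: hom_prod meval_lin_forms_lin_forms)
qed

lemma invariant_form_exists:
  fixes G :: "('k::field_char_0 ^ 'n::{finite,linorder} ^ 'n::{finite,linorder}) set"
  assumes "subgroup G GL" "finite G" "card G dvd d"
  shows "\<exists>f\<in>invariant_forms G d. f \<noteq> 0"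
proof -
  fix i :: 'n
  define N where "N = (\<Prod>g\<in>G. lin_forms g $ i)"
  \<comment> \<open>The norm \<open>N\<close> has degree \<open>card G\<close>, so its
    \<open>k\<close>-th power has degree \<open>d\<close>; for \<open>d = 0\<close> this power is
    the constant 1.\<close>
  from assms(3) obtain k where k: "d = k * card G" by (auto simp: dvd_def mult.commute)
  have "invertible g" if "g \<in> G" for g
    using subgroup.subset[OF assms(1)] that by (auto simp: GL_def)
  with assms(2) have "N \<noteq> 0" by (simp add: N_def lin_forms_nonzero)
  moreover have "is_form d (N ^ k)"
    using is_form_power[OF is_form_prod[of G 1 "\<lambda>g. lin_forms g $ i", OF is_form_lin_forms]]
    by (simp add: N_def k)
  moreover have "meval mconst (lin_forms g) (N ^ k) = N ^ k" if "g \<in> G" for g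
  proof -
    interpret unital_ring_hom "meval mconst (lin_forms g)"
      by (intro unital_ring_hom_meval unital_ring_hom_mconst)
    show ?thesis using prod_lin_forms_invariant[OF assms(1) that] by (simp add: hom_power N_def)
  qed
  ultimately show ?thesis by (intro bexI[of _ "N ^ k"]) (auto simp: invariant_forms_def)
qed

theorem theorem2p8:
  fixes G :: "('k::{alg_closed_field, field_char_0} ^ 'n::{finite,linorder} ^ 'n::{finite,linorder}) set"
    and d :: nat
  assumes "subgroup G GL" and "finite G"
  shows "(invariant_forms G d \<noteq> {0} \<longrightarrow>
            (\<exists>\<phi>. self_compression G \<phi> \<and> polynomial_homogeneous (d + 1) \<phi> \<and>
                 (d \<noteq> 0 \<longrightarrow> nontrivial \<phi>))) \<and>
         (card G dvd d \<longrightarrow> invariant_forms G d \<noteq> {0})"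
proof (intro conjI impI)
  assume "invariant_forms G d \<noteq> {0}"
  \<comment> \<open>Since 0 is always a member, differing from \<open>{0}\<close> really means
    containing a nonzero form.\<close>
  moreover have "0 \<in> invariant_forms G d" by (simp add: invariant_forms_def is_form_def)
  ultimately obtain f where f: "f \<in> invariant_forms G d" "f \<noteq> 0" by blast
  define P where "P = (\<chi> i. f * mvar i)"
  have form: "is_form (d + 1) (P $ i)" for i
    using f(1) is_form_mult[OF _ is_form_mvar, of d f i] by (simp add: P_def invariant_forms_def)
  have "self_compression G (ratmap_of P)"
    unfolding P_def by (rule self_compression_radial_map) fact+
  moreover have "polynomial_homogeneous (d + 1) (ratmap_of P)"
    using form by (auto simp: polynomial_homogeneous_def)
  moreover have "nontrivial (ratmap_of P)" if "d \<noteq> 0"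
    using nontrivial_polynomial_homogeneous[OF form] that by simp
  ultimately show "\<exists>\<phi>. self_compression G \<phi> \<and> polynomial_homogeneous (d + 1) \<phi> \<and>
      (d \<noteq> 0 \<longrightarrow> nontrivial \<phi>)" by blast
next
  assume "card G dvd d"
  with invariant_form_exists[OF assms] show "invariant_forms G d \<noteq> {0}" by blast
qed

end
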